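(* Let $M=(N,W,\eta)$ be a right $\Lambda$-module, $\Lambda=B[E]$, with $N\neq 0$ and $W\neq 0$. Then $M$ is a mixed brick if and only if $\eta$ is injective and $$\mathrm{Stab}_{\mathrm{End}_B(N)}(\mathrm{Im}\,\eta):=\{f\in \mathrm{End}_B(N)\mid f_*(\mathrm{Im}\,\eta)\subseteq \mathrm{Im}\,\eta\}=\Bbbk\,\mathrm{id}_N,$$ where $f_*\colon \mathrm{Hom}_B(E,N)\to \mathrm{Hom}_B(E,N)$, $\varphi\mapsto f\circ\varphi$, is the map induced by post-composition.
   Context: $\Bbbk$ is an algebraically closed field; all algebras are finite-dimensional over $\Bbbk$ and all modules are finite-dimensional right modules. $B$ is a $\Bbbk$-algebra, $E$ is a $\Bbbk$-$B$-bimodule (i.e. a right $B$-module), and $\Lambda=B[E]=\begin{pmatrix} B & 0 \\ E & \Bbbk \end{pmatrix}$ is the one-point extension of $B$ by $E$. Right $\Lambda$-modules are described by triples $(N,W,\eta)$ with $N$ a right $B$-module, $W$ a finite-dimensional $\Bbbk$-vector space and $\eta\colon W\to \mathrm{Hom}_B(E,N)$ a $\Bbbk$-linear map (the underlying space is $N\oplus W$ with action $(n,w)\begin{pmatrix} b & 0 \\ x & \lambda \end{pmatrix}=(nb+\eta(w)(x),\,w\lambda)$). A morphism $(N,W,\eta)\to(N',W',\eta')$ is a pair $(f,g)$ with $f\colon N\to N'$ $B$-linear and $g\colon W\to W'$ $\Bbbk$-linear such that $f_*\circ\eta=\eta'\circ g$, where $f_*(\varphi)=f\circ\varphi$. A brick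 is a module whose endomorphism algebra is a division algebra (equivalently, since $\Bbbk$ is algebraically closed, equal to $\Bbbk\,\mathrm{id}$). A mixed brick is a brick $(N,W,\eta)$ in $\mathrm{mod}\,\Lambda$ with $N\neq0$ and $W\neq0$. *)

theory Defs
  imports "HOL-Analysis.Analysis" "HOL-Library.Function_Algebras"
begin

text \<open>
  The product on an algebra is a parameter rather than a type class operation, because the
  product of a one-point extension depends on the module by which one extends.
\<close>

locale fd_algebra =
  fixes scale :: "'k::field \<Rightarrow> 'a::ab_group_add \<Rightarrow> 'a"
    and mult :: "'a \<Rightarrow> 'a \<Rightarrow> 'a"
    and unit :: 'a
  assumes finite_dim: "\<exists>Basis. finite_dimensional_vector_space scale Basis"
    and mult_assoc: "mult (mult a b) c = mult a (mult b c)"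
    and mult_unit_left: "mult unit a = a"
    and mult_unit_right: "mult a unit = a"
    and mult_add_left: "mult (a + b) c = mult a c + mult b c"
    and mult_add_right: "mult a (b + c) = mult a b + mult a c"
    and mult_scale_left: "mult (scale r a) b = scale r (mult a b)"
    and mult_scale_right: "mult a (scale r b) = scale r (mult a b)"

locale fd_right_module = fd_algebra scaleA mult unit
  for scaleA :: "'k::field \<Rightarrow> 'a::ab_group_add \<Rightarrow> 'a" and mult and unit +
  fixes scale :: "'k \<Rightarrow> 'm::ab_group_add \<Rightarrow> 'm"
    and act :: "'m \<Rightarrow> 'a \<Rightarrow> 'm"
  assumes module_finite_dim: "\<exists>Basis. finite_dimensional_vector_space scale Basis"
    and act_mult: "act x (mult a b) = act (act x a) b"
    and act_unit: "act x unit = x"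
    and act_add_left: "act (x + y) a = act x a + act y a"
    and act_add_right: "act x (a + b) = act x a + act x b"
    and act_scale_left: "act (scale r x) a = scale r (act x a)"
    and act_scale_right: "act x (scaleA r a) = scale r (act x a)"

definition Hom_right ::
  "('k::field \<Rightarrow> 'm::ab_group_add \<Rightarrow> 'm) \<Rightarrow> ('m \<Rightarrow> 'a \<Rightarrow> 'm) \<Rightarrow>
   ('k \<Rightarrow> 'n::ab_group_add \<Rightarrow> 'n) \<Rightarrow> ('n \<Rightarrow> 'a \<Rightarrow> 'n) \<Rightarrow> ('m \<Rightarrow> 'n) set"
  where "Hom_right scaleM actM scaleN actN =
    {f. Vector_Spaces.linear scaleM scaleN f \<and> (\<forall>x a. f (actM x a) = actN (f x) a)}"

definition End_right ::
  "('k::field \<Rightarrow> 'm::ab_group_add \<Rightarrow> 'm) \<Rightarrow> ('m \<Rightarrow> 'a \<Rightarrow> 'm) \<Rightarrow> ('m \<Rightarrow> 'm) set"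
  where "End_right scaleM actM = Hom_right scaleM actM scaleM actM"

text \<open>
  The endomorphism algebra has pointwise addition, composition as product and the identity as
  unit; that it is a division algebra means that it is not the zero algebra and that
  each nonzero element is invertible within it.
\<close>

definition brick ::
  "('k::field \<Rightarrow> 'a::ab_group_add \<Rightarrow> 'a) \<Rightarrow> ('a \<Rightarrow> 'a \<Rightarrow> 'a) \<Rightarrow> 'a \<Rightarrow>
   ('k \<Rightarrow> 'm::ab_group_add \<Rightarrow> 'm) \<Rightarrow> ('m \<Rightarrow> 'a \<Rightarrow> 'm) \<Rightarrow> bool"
  where "brick scaleA multA unitA scaleM actM \<longleftrightarrow>
    fd_right_module scaleA multA unitA scaleM actM \<and>
    (id :: 'm \<Rightarrow> 'm) \<noteq> 0 \<and>
    (\<forall>f \<in> End_right scaleM actM. f \<noteq> 0 \<longrightarrow>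
       (\<exists>g \<in> End_right scaleM actM. f \<circ> g = id \<and> g \<circ> f = id))"

text \<open>
  The triple \<open>(b, x, l)\<close> stands for the lower triangular matrix with diagonal entries
  \<open>b\<close>, \<open>l\<close> and with \<open>x\<close> in the lower left corner. The left action of the
  ground field on \<open>E\<close>, which makes it a bimodule, is scalar multiplication.
\<close>

definition ext_scale ::
  "('k::field \<Rightarrow> 'b::ab_group_add \<Rightarrow> 'b) \<Rightarrow> ('k \<Rightarrow> 'e::ab_group_add \<Rightarrow> 'e) \<Rightarrow>
   'k \<Rightarrow> 'b \<times> 'e \<times> 'k \<Rightarrow> 'b \<times> 'e \<times> 'k"
  where "ext_scale scaleB scaleE r = (\<lambda>(b, x, l). (scaleB r b, scaleE r x, r * l))"

definition ext_mult ::
  "('b \<Rightarrow> 'b \<Rightarrow> 'b) \<Rightarrow> ('k::field \<Rightarrow> 'e::ab_group_add \<Rightarrow> 'e) \<Rightarrow> ('e \<Rightarrow> 'b \<Rightarrow> 'e) \<Rightarrow>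
   'b \<times> 'e \<times> 'k \<Rightarrow> 'b \<times> 'e \<times> 'k \<Rightarrow> 'b \<times> 'e \<times> 'k"
  where "ext_mult multB scaleE actE =
    (\<lambda>(b, x, l) (b', x', l'). (multB b b', actE x b' + scaleE l x', l * l'))"

definition ext_unit :: "'b \<Rightarrow> 'b \<times> 'e::ab_group_add \<times> 'k::field"
  where "ext_unit unitB = (unitB, 0, 1)"

definition scale_fun :: "('k \<Rightarrow> 'n \<Rightarrow> 'n) \<Rightarrow> 'k \<Rightarrow> ('e \<Rightarrow> 'n) \<Rightarrow> 'e \<Rightarrow> 'n"
  where "scale_fun scaleN r \<phi> = (\<lambda>x. scaleN r (\<phi> x))"

text \<open>
  The \<open>B\<close>-linear maps \<open>E \<Rightarrow> N\<close> form a subspace of the space of all functions, so that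
  a linear map into the former is a linear map into the latter with values in the subspace.
\<close>

definition structure_map ::
  "('k::field \<Rightarrow> 'e::ab_group_add \<Rightarrow> 'e) \<Rightarrow> ('e \<Rightarrow> 'b \<Rightarrow> 'e) \<Rightarrow>
   ('k \<Rightarrow> 'n::ab_group_add \<Rightarrow> 'n) \<Rightarrow> ('n \<Rightarrow> 'b \<Rightarrow> 'n) \<Rightarrow>
   ('k \<Rightarrow> 'w::ab_group_add \<Rightarrow> 'w) \<Rightarrow> ('w \<Rightarrow> 'e \<Rightarrow> 'n) \<Rightarrow> bool"
  where "structure_map scaleE actE scaleN actN scaleW \<eta> \<longleftrightarrow>
    range \<eta> \<subseteq> Hom_right scaleE actE scaleN actN \<and>
    Vector_Spaces.linear scaleW (scale_fun scaleN) \<eta>"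

definition triple_scale ::
  "('k \<Rightarrow> 'n \<Rightarrow> 'n) \<Rightarrow> ('k \<Rightarrow> 'w \<Rightarrow> 'w) \<Rightarrow> 'k \<Rightarrow> 'n \<times> 'w \<Rightarrow> 'n \<times> 'w"
  where "triple_scale scaleN scaleW r = (\<lambda>(n, w). (scaleN r n, scaleW r w))"

definition triple_act ::
  "('n::ab_group_add \<Rightarrow> 'b \<Rightarrow> 'n) \<Rightarrow> ('k \<Rightarrow> 'w \<Rightarrow> 'w) \<Rightarrow> ('w \<Rightarrow> 'e \<Rightarrow> 'n) \<Rightarrow>
   'n \<times> 'w \<Rightarrow> 'b \<times> 'e \<times> 'k \<Rightarrow> 'n \<times> 'w"
  where "triple_act actN scaleW \<eta> =
    (\<lambda>(n, w) (b, x, l). (actN n b + \<eta> w x, scaleW l w))"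

definition mixed_brick ::
  "('k::field \<Rightarrow> 'b::ab_group_add \<Rightarrow> 'b) \<Rightarrow> ('b \<Rightarrow> 'b \<Rightarrow> 'b) \<Rightarrow> 'b \<Rightarrow>
   ('k \<Rightarrow> 'e::ab_group_add \<Rightarrow> 'e) \<Rightarrow> ('e \<Rightarrow> 'b \<Rightarrow> 'e) \<Rightarrow>
   ('k \<Rightarrow> 'n::ab_group_add \<Rightarrow> 'n) \<Rightarrow> ('n \<Rightarrow> 'b \<Rightarrow> 'n) \<Rightarrow>
   ('k \<Rightarrow> 'w::ab_group_add \<Rightarrow> 'w) \<Rightarrow> ('w \<Rightarrow> 'e \<Rightarrow> 'n) \<Rightarrow> bool"
  where "mixed_brick scaleB multB unitB scaleE actE scaleN actN scaleW \<eta> \<longleftrightarrow>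
    brick (ext_scale scaleB scaleE) (ext_mult multB scaleE actE) (ext_unit unitB)
      (triple_scale scaleN scaleW) (triple_act actN scaleW \<eta>) \<and>
    (\<exists>n::'n. n \<noteq> 0) \<and> (\<exists>w::'w. w \<noteq> 0)"

definition stabilizer ::
  "('k::field \<Rightarrow> 'n::ab_group_add \<Rightarrow> 'n) \<Rightarrow> ('n \<Rightarrow> 'b \<Rightarrow> 'n) \<Rightarrow> ('e \<Rightarrow> 'n) set \<Rightarrow> ('n \<Rightarrow> 'n) set"
  where "stabilizer scaleN actN U =
    {f \<in> End_right scaleN actN. (\<lambda>\<phi>. f \<circ> \<phi>) ` U \<subseteq> U}"

text \<open>
  The next lemmas confirm that the one-point extension is an algebra, that the triple
  \<open>(N, W, \<eta>)\<close> is a right module over it, and that the endomorphisms of this module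
  are the endomorphisms of the triple.
\<close>

lemma finite_dim_prod:
  assumes "\<exists>B. finite_dimensional_vector_space s1 B"
    and "\<exists>B. finite_dimensional_vector_space s2 B"
  shows "\<exists>B. finite_dimensional_vector_space (\<lambda>r (x, y). (s1 r x, s2 r y)) B"
proof -
  obtain B1 B2 where "finite_dimensional_vector_space s1 B1" "finite_dimensional_vector_space s2 B2"
    using assms by blast
  then interpret finite_dimensional_vector_space_prod s1 s2 B1 B2
    by (simp add: finite_dimensional_vector_space_prod_def finite_dimensional_vector_space_pair_def
        vector_space_prod_def vector_space_pair_def finite_dimensional_vector_space_def)
  have "module_prod.scale s1 s2 = (\<lambda>r (x, y). (s1 r x, s2 r y))"
    by (auto simp: fun_eq_iff scale_prod)
  then show ?thesis
    using p.finite_dimensional_vector_space_axioms by metis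
qed

lemma finite_dim_imp_vector_space:
  "\<exists>B. finite_dimensional_vector_space s B \<Longrightarrow> vector_space s"
  by (auto simp: finite_dimensional_vector_space_def)

lemma finite_dim_field: "\<exists>B. finite_dimensional_vector_space ((*) :: 'k::field \<Rightarrow> 'k \<Rightarrow> 'k) B"
proof -
  have "finite_dimensional_vector_space ((*) :: 'k \<Rightarrow> 'k \<Rightarrow> 'k) {1}"
    by unfold_locales
  then show ?thesis ..
qed

lemma fd_algebra_ext:
  assumes "fd_right_module scaleB multB unitB scaleE actE"
  shows "fd_algebra (ext_scale scaleB scaleE) (ext_mult multB scaleE actE) (ext_unit unitB)"
proof -
  interpret fd_right_module scaleB multB unitB scaleE actE by fact
  interpret VB: vector_space scaleB by (rule finite_dim_imp_vector_space[OF finite_dim])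
  interpret VE: vector_space scaleE by (rule finite_dim_imp_vector_space[OF module_finite_dim])
  have "\<exists>B. finite_dimensional_vector_space (ext_scale scaleB scaleE) B"
    using finite_dim_prod[OF finite_dim finite_dim_prod[OF module_finite_dim finite_dim_field]]
    unfolding ext_scale_def[abs_def] by (simp add: case_prod_unfold)
  moreover have "actE 0 b = 0" for b
    using act_add_left[of 0 0 b] by simp
  ultimately show ?thesis
    by unfold_locales
      (auto simp: ext_mult_def ext_unit_def ext_scale_def mult_assoc mult_unit_left mult_unit_right
        mult_add_left mult_add_right mult_scale_left mult_scale_right act_mult act_unit act_add_left
        act_add_right act_scale_left act_scale_right algebra_simps VE.scale_right_distrib
        VE.scale_left_distrib)
qed

lemma fd_right_module_triple:
  assumes "fd_right_module scaleB multB unitB scaleE actE"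
    and "fd_right_module scaleB multB unitB scaleN actN"
    and finW: "\<exists>Basis. finite_dimensional_vector_space scaleW Basis"
    and eta: "structure_map scaleE actE scaleN actN scaleW \<eta>"
  shows "fd_right_module (ext_scale scaleB scaleE) (ext_mult multB scaleE actE) (ext_unit unitB)
    (triple_scale scaleN scaleW) (triple_act actN scaleW \<eta>)"
proof -
  interpret E: fd_right_module scaleB multB unitB scaleE actE by fact
  interpret N: fd_right_module scaleB multB unitB scaleN actN by fact
  interpret VN: vector_space scaleN by (rule finite_dim_imp_vector_space[OF N.module_finite_dim])
  interpret VW: vector_space scaleW by (rule finite_dim_imp_vector_space[OF finW])
  interpret L: fd_algebra "ext_scale scaleB scaleE" "ext_mult multB scaleE actE" "ext_unit unitB"
    by (rule fd_algebra_ext) fact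
  have hom: "\<eta> w (x + y) = \<eta> w x + \<eta> w y" "\<eta> w (scaleE r x) = scaleN r (\<eta> w x)"
    "\<eta> w (actE x b) = actN (\<eta> w x) b" for w x y r b
  proof -
    have "\<eta> w \<in> Hom_right scaleE actE scaleN actN"
      using eta by (auto simp: structure_map_def)
    then show "\<eta> w (x + y) = \<eta> w x + \<eta> w y" "\<eta> w (scaleE r x) = scaleN r (\<eta> w x)"
      "\<eta> w (actE x b) = actN (\<eta> w x) b"
      by (auto simp: Hom_right_def Vector_Spaces.linear_iff)
  qed
  have lin: "\<eta> (v + w) x = \<eta> v x + \<eta> w x" "\<eta> (scaleW r w) x = scaleN r (\<eta> w x)" for v w r x
    using eta by (auto simp: structure_map_def scale_fun_def Vector_Spaces.linear_iff)
  have "\<eta> w 0 = 0" for w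
    using hom(1)[of w 0 0] by simp
  moreover have "\<exists>B. finite_dimensional_vector_space (triple_scale scaleN scaleW) B"
    using finite_dim_prod[OF N.module_finite_dim finW]
    unfolding triple_scale_def[abs_def] .
  ultimately show ?thesis
    by unfold_locales
      (auto simp: triple_act_def triple_scale_def ext_mult_def ext_unit_def ext_scale_def
        hom lin N.act_mult N.act_unit N.act_add_left N.act_add_right N.act_scale_left
        N.act_scale_right VN.scale_right_distrib VW.scale_right_distrib VW.scale_left_distrib
        algebra_simps)
qed

lemma End_triple_iff:
  assumes "fd_right_module scaleB multB unitB scaleE actE"
    and "fd_right_module scaleB multB unitB scaleN actN"
    and finW: "\<exists>Basis. finite_dimensional_vector_space scaleW Basis"
    and eta: "structure_map scaleE actE scaleN actN scaleW \<eta>"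
  shows "h \<in> End_right (triple_scale scaleN scaleW) (triple_act actN scaleW \<eta>) \<longleftrightarrow>
    (\<exists>f g. h = map_prod f g \<and> f \<in> End_right scaleN actN \<and>
      Vector_Spaces.linear scaleW scaleW g \<and> (\<forall>w. f \<circ> \<eta> w = \<eta> (g w)))"
    (is "?L \<longleftrightarrow> ?R")
proof -
  interpret E: fd_right_module scaleB multB unitB scaleE actE by fact
  interpret N: fd_right_module scaleB multB unitB scaleN actN by fact
  interpret VN: vector_space scaleN by (rule finite_dim_imp_vector_space[OF N.module_finite_dim])
  interpret VW: vector_space scaleW by (rule finite_dim_imp_vector_space[OF finW])
  interpret M: fd_right_module "ext_scale scaleB scaleE" "ext_mult multB scaleE actE"
    "ext_unit unitB" "triple_scale scaleN scaleW" "triple_act actN scaleW \<eta>"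
    by (rule fd_right_module_triple) fact+
  interpret VM: vector_space "triple_scale scaleN scaleW"
    by (rule finite_dim_imp_vector_space[OF M.module_finite_dim])
  have eta_0: "\<eta> w 0 = 0" "\<eta> 0 x = 0" for w x
  proof -
    have "\<eta> w (0 + 0) = \<eta> w 0 + \<eta> w 0"
      using eta unfolding structure_map_def Hom_right_def Vector_Spaces.linear_iff by blast
    then show "\<eta> w 0 = 0" by simp
    have "\<eta> (0 + 0) = \<eta> 0 + \<eta> 0"
      using eta unfolding structure_map_def Vector_Spaces.linear_iff by blast
    then show "\<eta> 0 x = 0" by simp
  qed
  have act_0: "actN n 0 = 0" "actN 0 b = 0" for n b
    using N.act_add_right[of n 0 0] N.act_add_left[of 0 0 b] by auto
  show ?thesis
  proof
    assume ?L
    then have add: "h (p + q) = h p + h q"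
      and scale: "h (triple_scale scaleN scaleW r p) = triple_scale scaleN scaleW r (h p)"
      and act: "h (triple_act actN scaleW \<eta> p a) = triple_act actN scaleW \<eta> (h p) a" for p q r a
      unfolding End_right_def Hom_right_def Vector_Spaces.linear_iff by blast+
    define f where "f n = fst (h (n, 0))" for n
    define g where "g w = snd (h (0, w))" for w
    have hn: "h (n, 0) = (f n, 0)" for n
      using act[of "(n, 0)" "(unitB, 0, 0)"]
      by (cases "h (n, 0)") (auto simp: triple_act_def f_def N.act_unit eta_0)
    have hw: "h (0, w) = (0, g w)" for w
      using act[of "(0, w)" "(0, 0, 1)"]
      by (cases "h (0, w)") (auto simp: triple_act_def g_def eta_0 act_0)
    have "h (n, w) = (f n, g w)" for n w
      using add[of "(n, 0)" "(0, w)"] by (simp add: hn hw)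
    then have h: "h = map_prod f g"
      by (auto simp: fun_eq_iff)
    have "f (m + n) = f m + f n" "f (scaleN r n) = scaleN r (f n)" "f (actN n b) = actN (f n) b"
      for m n r b
      using add[of "(m, 0)" "(n, 0)"] scale[of r "(n, 0)"] act[of "(n, 0)" "(b, 0, 0)"]
      by (auto simp: h triple_scale_def triple_act_def eta_0)
    then have "f \<in> End_right scaleN actN"
      using VN.vector_space_axioms
      by (auto simp: End_right_def Hom_right_def Vector_Spaces.linear_iff)
    moreover have "g (v + w) = g v + g w" "g (scaleW r w) = scaleW r (g w)" for v w r
      using add[of "(0, v)" "(0, w)"] scale[of r "(0, w)"]
      by (auto simp: h triple_scale_def)
    then have "Vector_Spaces.linear scaleW scaleW g"
      using VW.vector_space_axioms by (auto simp: Vector_Spaces.linear_iff)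
    moreover have "f (\<eta> w x) = \<eta> (g w) x" for w x
    proof -
      have "f 0 = 0" using hw[of 0] h by simp
      then show ?thesis
        using act[of "(0, w)" "(0, x, 0)"] by (auto simp: h triple_act_def act_0)
    qed
    ultimately show ?R
      using h by (auto simp: fun_eq_iff)
  next
    assume ?R
    then obtain f g where h: "h = map_prod f g" and f: "f \<in> End_right scaleN actN"
      and g: "Vector_Spaces.linear scaleW scaleW g" and "\<And>w. f \<circ> \<eta> w = \<eta> (g w)"
      by blast
    then have "f (\<eta> w x) = \<eta> (g w) x" for w x
      by (metis comp_apply)
    then show ?L
      using f g VM.vector_space_axioms
      by (auto simp: h End_right_def Hom_right_def Vector_Spaces.linear_iff
          triple_scale_def triple_act_def)
  qed
qed

end

theory Submission
  imports Defs
begin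

text \<open>
  The argument is Schur's lemma combined with the description of the endomorphisms of
  \<open>M = (N, W, \<eta>)\<close> as pairs \<open>(f, g)\<close> with \<open>f \<circ> \<eta> w = \<eta> (g w)\<close> for all \<open>w\<close>.

  Such a pair has its first component \<open>f\<close> in the stabilizer of \<open>Im \<eta>\<close>. If \<open>\<eta>\<close> is injective,
  then \<open>f\<close> determines \<open>g\<close>, and each \<open>f\<close> in the stabilizer extends to a pair: for given \<open>w\<close>, the map
  \<open>f \<circ> \<eta> w\<close> lies in \<open>Im \<eta>\<close> and has a unique preimage \<open>g w\<close>. So for injective \<open>\<eta>\<close> the endomorphisms
  of \<open>M\<close> correspond to the elements of the stabilizer, with scalars corresponding to scalars.
  On the other hand, if \<open>\<eta> w\<^sub>0 = 0\<close> with \<open>w\<^sub>0 \<noteq> 0\<close>, then a linear map \<open>g\<close> from \<open>W\<close> onto the line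
  through \<open>w\<^sub>0\<close> gives a nonzero endomorphism \<open>(0, g)\<close>, which is not invertible because \<open>N \<noteq> 0\<close>; hence
  \<open>\<eta>\<close> is injective when \<open>M\<close> is a brick.

  It remains to compare division algebras with scalars. Over an algebraically closed field an
  endomorphism \<open>h\<close> of a nonzero finite-dimensional space has an eigenvalue \<open>c\<close>, so \<open>h - c\<close> is not
  injective; in a division algebra of endomorphisms this forces \<open>h = c\<close>.
\<close>

section \<open>Eigenvectors over an algebraically closed field\<close>

text \<open>
  The vector \<open>p(h) v\<close>, computed by Horner's scheme. Horner's form makes the recursion along
  \<open>pCons\<close> valid without a case distinction on the zero polynomial.
\<close>

definition poly_orbit ::
  "('k::field \<Rightarrow> 'm::ab_group_add \<Rightarrow> 'm) \<Rightarrow> ('m \<Rightarrow> 'm) \<Rightarrow> 'm \<Rightarrow> 'k poly \<Rightarrow> 'm"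
  where "poly_orbit s h v p = foldr (\<lambda>a x. s a v + h x) (coeffs p) 0"

lemma poly_orbit_0 [simp]: "poly_orbit s h v 0 = 0"
  by (simp add: poly_orbit_def)

context
  fixes scale :: "'k::field \<Rightarrow> 'm::ab_group_add \<Rightarrow> 'm" and h :: "'m \<Rightarrow> 'm"
  assumes linear: "Vector_Spaces.linear scale scale h"
begin

interpretation H: Vector_Spaces.linear scale scale h
  by (rule linear)

lemma poly_orbit_pCons [simp]:
  "poly_orbit scale h v (pCons a p) = scale a v + h (poly_orbit scale h v p)"
  by (auto simp: poly_orbit_def cCons_def H.zero)

lemma poly_orbit_add: "poly_orbit scale h v (p + q) = poly_orbit scale h v p + poly_orbit scale h v q"
  by (induction p q rule: poly_induct2) (simp_all add: H.add H.vs1.scale_left_distrib algebra_simps)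

lemma poly_orbit_smult: "poly_orbit scale h v (smult c p) = scale c (poly_orbit scale h v p)"
  by (induction p) (simp_all add: H.scale H.vs1.scale_right_distrib)

lemma poly_orbit_sum:
  "poly_orbit scale h v (\<Sum>i\<in>I. p i) = (\<Sum>i\<in>I. poly_orbit scale h v (p i))"
  by (induction I rule: infinite_finite_induct) (simp_all add: poly_orbit_add)

lemma poly_orbit_monom: "poly_orbit scale h v (monom c n) = scale c ((h ^^ n) v)"
  by (induction n) (simp_all add: monom_Suc monom_0 H.zero H.scale)

lemma poly_orbit_linear_factor:
  "poly_orbit scale h v ([:- c, 1:] * p) = h (poly_orbit scale h v p) - scale c (poly_orbit scale h v p)"
proof -
  have "[:- c, 1:] * p = smult (- c) p + pCons 0 p"
    by simp
  then show ?thesis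
    by (simp only: poly_orbit_add poly_orbit_smult poly_orbit_pCons H.vs1.scale_minus_left) simp
qed

text \<open>
  If two of the first \<open>dim + 1\<close> iterates \<open>v, h v, h\<^sup>2 v, \<dots>\<close> coincide, then a difference of two
  monomials annihilates \<open>v\<close>; otherwise these iterates form a set with more than \<open>dim\<close> elements,
  and the coefficients of a linear dependence are those of an annihilating polynomial.
\<close>

lemma ex_annihilating_poly:
  assumes fin: "finite_dimensional_vector_space scale B"
  shows "\<exists>p. p \<noteq> 0 \<and> poly_orbit scale h v p = 0"
proof -
  interpret V: finite_dimensional_vector_space scale B by (rule fin)
  let ?I = "{..V.dimension}"
  let ?o = "\<lambda>i. (h ^^ i) v"
  show ?thesis
  proof (cases "inj_on ?o ?I")
    case False
    then obtain i j where ij: "i \<noteq> j" "?o i = ?o j"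
      by (auto simp: inj_on_def)
    let ?p = "monom 1 i + monom (- 1 :: 'k) j"
    have "coeff ?p i \<noteq> 0"
      using ij by simp
    then have "?p \<noteq> 0"
      by (metis coeff_0)
    moreover have "poly_orbit scale h v ?p = 0"
      by (simp add: poly_orbit_add poly_orbit_monom ij)
    ultimately show ?thesis by blast
  next
    case True
    have "H.vs1.dependent (?o ` ?I)"
    proof (rule ccontr)
      assume "H.vs1.independent (?o ` ?I)"
      then have "card (?o ` ?I) \<le> H.vs1.dim (?o ` ?I)"
        using V.independent_bound_general by blast
      also have "\<dots> \<le> V.dimension"
        by (rule V.dim_subset_UNIV)
      finally show False
        by (simp add: card_image[OF True])
    qed
    then obtain u i where i: "i \<in> ?I" "u (?o i) \<noteq> 0" and u: "(\<Sum>x\<in>?o ` ?I. scale (u x) x) = 0"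
      by (auto simp: H.vs1.dependent_finite)
    let ?p = "\<Sum>i\<in>?I. monom (u (?o i)) i"
    have "coeff ?p i = u (?o i)"
      using i by (simp add: coeff_sum)
    then have "?p \<noteq> 0"
      using i by (metis coeff_0)
    moreover have "poly_orbit scale h v ?p = 0"
      using u by (simp add: poly_orbit_sum poly_orbit_monom sum.reindex[OF True])
    ultimately show ?thesis by blast
  qed
qed

end

text \<open>
  Split a linear factor \<open>X - c\<close> off a polynomial \<open>p\<close> with \<open>p(h) v = 0\<close>. The cofactor \<open>q\<close> either
  annihilates \<open>v\<close> as well and has smaller degree, or \<open>q(h) v\<close> is an eigenvector for \<open>c\<close>.
\<close>

lemma ex_eigenvector_of_annihilating_poly:
  fixes scale :: "'k::alg_closed_field \<Rightarrow> 'm::ab_group_add \<Rightarrow> 'm"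
  assumes linear: "Vector_Spaces.linear scale scale h"
    and "v \<noteq> 0" and "p \<noteq> 0" and "poly_orbit scale h v p = 0"
  shows "\<exists>c u. u \<noteq> 0 \<and> h u = scale c u"
  using assms(3,4)
proof (induction "degree p" arbitrary: p rule: less_induct)
  case less
  interpret H: Vector_Spaces.linear scale scale h by (rule linear)
  have "degree p > 0"
  proof (rule ccontr)
    assume "\<not> degree p > 0"
    then obtain a where "p = [:a:]"
      by (auto elim: degree_eq_zeroE)
    then show False
      using less.prems \<open>v \<noteq> 0\<close> by (simp add: poly_orbit_pCons[OF linear] H.zero)
  qed
  then obtain c where "poly p c = 0"
    using alg_closed_imp_poly_has_root by blast
  then obtain q where p: "p = [:- c, 1:] * q"
    by (auto simp: poly_eq_0_iff_dvd elim: dvdE)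
  then have "q \<noteq> 0"
    using less.prems by auto
  then have "degree q < degree p"
    unfolding p by (subst degree_mult_eq) auto
  show ?case
  proof (cases "poly_orbit scale h v q = 0")
    case True
    then show ?thesis
      using less.hyps \<open>degree q < degree p\<close> \<open>q \<noteq> 0\<close> by blast
  next
    case False
    moreover have "h (poly_orbit scale h v q) = scale c (poly_orbit scale h v q)"
      using less.prems(2) unfolding p poly_orbit_linear_factor[OF linear] by simp
    ultimately show ?thesis by blast
  qed
qed

lemma ex_eigenvector:
  fixes scale :: "'k::alg_closed_field \<Rightarrow> 'm::ab_group_add \<Rightarrow> 'm"
  assumes "\<exists>Basis. finite_dimensional_vector_space scale Basis"
    and "Vector_Spaces.linear scale scale h" and "\<exists>v::'m. v \<noteq> 0"
  shows "\<exists>c u. u \<noteq> 0 \<and> h u = scale c u"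
  using assms ex_annihilating_poly ex_eigenvector_of_annihilating_poly by metis

section \<open>Schur's lemma\<close>

lemma (in fd_right_module) End_right_scale:
  "scale c \<in> End_right scale act"
proof -
  interpret vector_space scale
    by (rule finite_dim_imp_vector_space[OF module_finite_dim])
  show ?thesis
    by (simp add: End_right_def Hom_right_def Vector_Spaces.linear_iff vector_space_axioms
        scale_right_distrib act_scale_left mult.commute)
qed

lemma (in fd_right_module) End_right_diff:
  assumes "f \<in> End_right scale act" and "g \<in> End_right scale act"
  shows "(\<lambda>x. f x - g x) \<in> End_right scale act"
proof -
  interpret vector_space scale
    by (rule finite_dim_imp_vector_space[OF module_finite_dim])
  have "act (x - y) a = act x a - act y a" for x y a
    using act_add_left[of "x - y" y a] by (simp add: algebra_simps)
  then show ?thesis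
    using assms by (simp add: End_right_def Hom_right_def Vector_Spaces.linear_iff
        scale_right_diff_distrib)
qed

lemma brick_inverse:
  fixes scale :: "'k::field \<Rightarrow> 'm::ab_group_add \<Rightarrow> 'm"
  assumes "brick scaleA multA unitA scale act" and "f \<in> End_right scale act" and "f \<noteq> 0"
  obtains g where "g \<in> End_right scale act" and "f \<circ> g = id" and "g \<circ> f = id"
  using assms by (auto simp: brick_def)

text \<open>
  For an eigenvalue \<open>c\<close> of \<open>h\<close>, the endomorphism \<open>h - c\<close> kills an eigenvector, so it is not
  invertible and must vanish.
\<close>

lemma brick_End_right_scalar:
  fixes scaleA :: "'k::alg_closed_field \<Rightarrow> 'a::ab_group_add \<Rightarrow> 'a"
    and scale :: "'k \<Rightarrow> 'm::ab_group_add \<Rightarrow> 'm"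
  assumes brick: "brick scaleA multA unitA scale act"
    and h: "h \<in> End_right scale act"
  shows "\<exists>c. h = scale c"
proof -
  interpret fd_right_module scaleA multA unitA scale act
    using brick by (simp add: brick_def)
  have lin: "Vector_Spaces.linear scale scale h"
    using h by (simp add: End_right_def Hom_right_def)
  have "\<exists>v::'m. v \<noteq> 0"
    using brick by (auto simp: brick_def fun_eq_iff)
  then obtain c u where u: "u \<noteq> 0" "h u = scale c u"
    using ex_eigenvector[OF module_finite_dim lin] by blast
  let ?d = "\<lambda>x. h x - scale c x"
  have "?d = 0"
  proof (rule ccontr)
    assume "?d \<noteq> 0"
    then obtain g where g: "g \<in> End_right scale act" "g \<circ> ?d = id"
      using brick_inverse[OF brick End_right_diff[OF h End_right_scale]] by blast
    have "g 0 = 0"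
      using g(1) by (auto simp: End_right_def Hom_right_def Vector_Spaces.linear_iff)
        (metis add_cancel_right_right add_0)
    then show False
      using g(2) u by (auto simp: fun_eq_iff dest: spec[of _ u])
  qed
  then have "h = scale c"
    by (auto simp: fun_eq_iff)
  then show ?thesis ..
qed

text \<open>Conversely, scalar endomorphisms form a division algebra, because the nonzero scalars of a field are invertible.\<close>

lemma brick_if_End_right_scalar:
  fixes scale :: "'k::field \<Rightarrow> 'm::ab_group_add \<Rightarrow> 'm"
  assumes M: "fd_right_module scaleA multA unitA scale act" and nz: "\<exists>v::'m. v \<noteq> 0"
    and scalar: "\<And>h. h \<in> End_right scale act \<Longrightarrow> \<exists>c. h = scale c"
  shows "brick scaleA multA unitA scale act"
  unfolding brick_def
proof (intro conjI ballI impI)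
  interpret fd_right_module scaleA multA unitA scale act by (rule M)
  interpret vector_space scale
    by (rule finite_dim_imp_vector_space[OF module_finite_dim])
  show "(id :: 'm \<Rightarrow> 'm) \<noteq> 0"
    using nz by (auto simp: fun_eq_iff)
  fix f assume "f \<in> End_right scale act" "f \<noteq> 0"
  then obtain c where c: "f = scale c"
    using scalar by blast
  with \<open>f \<noteq> 0\<close> have "c \<noteq> 0"
    by (auto simp: fun_eq_iff)
  then have "f \<circ> scale (inverse c) = id \<and> scale (inverse c) \<circ> f = id"
    by (simp add: c fun_eq_iff)
  then show "\<exists>g\<in>End_right scale act. f \<circ> g = id \<and> g \<circ> f = id"
    using End_right_scale by blast
qed (rule M)

section \<open>Mixed bricks\<close>

text \<open>
  If \<open>\<eta> w\<^sub>0 = 0\<close> with \<open>w\<^sub>0 \<noteq> 0\<close>, then a functional \<open>\<phi>\<close> with \<open>\<phi> w\<^sub>0 = 1\<close> gives the linear map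
  \<open>g w = \<phi> w \<cdot> w\<^sub>0\<close> with image in the kernel of \<open>\<eta>\<close>. The endomorphism \<open>(0, g)\<close> is nonzero, but it
  is not invertible because \<open>N \<noteq> 0\<close>.
\<close>

lemma brick_triple_imp_inj:
  fixes scaleN :: "'k::field \<Rightarrow> 'n::ab_group_add \<Rightarrow> 'n"
    and scaleW :: "'k \<Rightarrow> 'w::ab_group_add \<Rightarrow> 'w"
  assumes E: "fd_right_module scaleB multB unitB scaleE actE"
    and N: "fd_right_module scaleB multB unitB scaleN actN"
    and W: "\<exists>Basis. finite_dimensional_vector_space scaleW Basis"
    and eta: "structure_map scaleE actE scaleN actN scaleW \<eta>"
    and nz: "\<exists>n::'n. n \<noteq> 0"
    and brick: "brick (ext_scale scaleB scaleE) (ext_mult multB scaleE actE) (ext_unit unitB)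
      (triple_scale scaleN scaleW) (triple_act actN scaleW \<eta>)"
  shows "inj \<eta>"
proof -
  interpret N: fd_right_module scaleB multB unitB scaleN actN by (rule N)
  interpret VN: vector_space scaleN by (rule finite_dim_imp_vector_space[OF N.module_finite_dim])
  interpret VW: vector_space scaleW by (rule finite_dim_imp_vector_space[OF W])
  interpret L: Vector_Spaces.linear scaleW "scale_fun scaleN" \<eta>
    using eta by (simp add: structure_map_def)
  interpret P: vector_space_pair scaleW "(*) :: 'k \<Rightarrow> 'k \<Rightarrow> 'k"
    by (intro vector_space_pair.intro VW.vector_space_axioms
        finite_dim_imp_vector_space[OF finite_dim_field])
  have "w0 = 0" if w0: "\<eta> w0 = 0" for w0
  proof (rule ccontr)
    assume "w0 \<noteq> 0"
    then have "VW.independent {w0}"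
      by simp
    from P.linear_independent_extend[OF this, of "\<lambda>_. 1"]
    obtain \<phi> where \<phi>: "Vector_Spaces.linear scaleW (*) \<phi>" "\<phi> w0 = 1"
      by auto
    let ?g = "\<lambda>w. scaleW (\<phi> w) w0"
    have "Vector_Spaces.linear scaleW scaleW ?g"
      using \<phi>(1) by (simp add: Vector_Spaces.linear_iff VW.scale_left_distrib)
    moreover have "0 \<circ> \<eta> w = \<eta> (?g w)" for w
      by (simp add: L.scale w0 scale_fun_def fun_eq_iff)
    moreover have "0 \<in> End_right scaleN actN"
      using N.End_right_scale[of 0] by (simp add: zero_fun_def VN.scale_zero_left[abs_def])
    ultimately have "map_prod 0 ?g \<in> End_right (triple_scale scaleN scaleW) (triple_act actN scaleW \<eta>)"
      unfolding End_triple_iff[OF E N W eta] by blast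
    moreover have "map_prod 0 ?g \<noteq> (0 :: 'n \<times> 'w \<Rightarrow> 'n \<times> 'w)"
    proof
      assume "map_prod 0 ?g = (0 :: 'n \<times> 'w \<Rightarrow> 'n \<times> 'w)"
      from fun_cong[OF this, of "(0, w0)"] show False
        using \<open>w0 \<noteq> 0\<close> by (simp add: \<phi>(2) zero_prod_def)
    qed
    ultimately obtain k :: "'n \<times> 'w \<Rightarrow> 'n \<times> 'w" where k: "map_prod 0 ?g \<circ> k = id"
      by (rule brick_inverse[OF brick]) (rule that)
    have "n = 0" for n :: 'n
    proof -
      have "n = fst ((map_prod 0 ?g \<circ> k) (n, 0))"
        by (simp only: k id_apply fst_conv)
      then show ?thesis by simp
    qed
    then show False
      using nz by blast
  qed
  then have "v - w = 0" if "\<eta> v = \<eta> w" for v w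
    using that by (simp only: L.diff diff_self)
  then show ?thesis
    by (simp add: inj_def)
qed

text \<open>
  The second component of the pair extending \<open>f\<close> is \<open>\<eta>\<^sup>-\<^sup>1 \<circ> f\<^sub>* \<circ> \<eta>\<close>; injectivity of \<open>\<eta>\<close> makes it linear.
\<close>

lemma stabilizer_extends_to_triple:
  assumes E: "fd_right_module scaleB multB unitB scaleE actE"
    and N: "fd_right_module scaleB multB unitB scaleN actN"
    and W: "\<exists>Basis. finite_dimensional_vector_space scaleW Basis"
    and eta: "structure_map scaleE actE scaleN actN scaleW \<eta>"
    and inj: "inj \<eta>" and f: "f \<in> stabilizer scaleN actN (range \<eta>)"
  shows "\<exists>g. map_prod f g \<in> End_right (triple_scale scaleN scaleW) (triple_act actN scaleW \<eta>)"
proof -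
  interpret VW: vector_space scaleW by (rule finite_dim_imp_vector_space[OF W])
  interpret L: Vector_Spaces.linear scaleW "scale_fun scaleN" \<eta>
    using eta by (simp add: structure_map_def)
  have fE: "f \<in> End_right scaleN actN"
    using f by (simp add: stabilizer_def)
  then have add: "f (x + y) = f x + f y" and scale: "f (scaleN c x) = scaleN c (f x)" for x y c
    by (auto simp: End_right_def Hom_right_def Vector_Spaces.linear_iff)
  have "\<forall>w. \<exists>w'. f \<circ> \<eta> w = \<eta> w'"
    using f unfolding stabilizer_def by blast
  then obtain g where g: "f \<circ> \<eta> w = \<eta> (g w)" for w
    by metis
  have g': "\<eta> (g w) x = f (\<eta> w x)" for w x
    by (metis comp_apply g)
  have "\<eta> (g (v + w)) = \<eta> (g v + g w)" for v w
    by (simp add: fun_eq_iff L.add g' add)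
  moreover have "\<eta> (g (scaleW c w)) = \<eta> (scaleW c (g w))" for c w
    by (simp add: fun_eq_iff L.scale g' scale scale_fun_def)
  ultimately have "Vector_Spaces.linear scaleW scaleW g"
    using VW.vector_space_axioms by (simp add: Vector_Spaces.linear_iff inj_eq[OF inj])
  then show ?thesis
    unfolding End_triple_iff[OF E N W eta] using fE g by blast
qed

lemma scalar_in_stabilizer:
  assumes N: "fd_right_module scaleB multB unitB scaleN actN"
    and eta: "structure_map scaleE actE scaleN actN scaleW \<eta>"
  shows "scaleN c \<in> stabilizer scaleN actN (range \<eta>)"
proof -
  interpret N: fd_right_module scaleB multB unitB scaleN actN by (rule N)
  interpret L: Vector_Spaces.linear scaleW "scale_fun scaleN" \<eta>
    using eta by (simp add: structure_map_def)
  have "scaleN c \<circ> \<eta> w = \<eta> (scaleW c w)" for w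
    by (simp add: L.scale scale_fun_def fun_eq_iff)
  then show ?thesis
    using N.End_right_scale by (auto simp: stabilizer_def)
qed

theorem theorem1:
  fixes scaleB :: "'k::alg_closed_field \<Rightarrow> 'b::ab_group_add \<Rightarrow> 'b"
    and multB :: "'b \<Rightarrow> 'b \<Rightarrow> 'b" and unitB :: 'b
    and scaleE :: "'k \<Rightarrow> 'e::ab_group_add \<Rightarrow> 'e" and actE :: "'e \<Rightarrow> 'b \<Rightarrow> 'e"
    and scaleN :: "'k \<Rightarrow> 'n::ab_group_add \<Rightarrow> 'n" and actN :: "'n \<Rightarrow> 'b \<Rightarrow> 'n"
    and scaleW :: "'k \<Rightarrow> 'w::ab_group_add \<Rightarrow> 'w"
    and \<eta> :: "'w \<Rightarrow> 'e \<Rightarrow> 'n"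
  assumes "fd_algebra scaleB multB unitB"
    and "fd_right_module scaleB multB unitB scaleE actE"
    and "fd_right_module scaleB multB unitB scaleN actN"
    and "\<exists>Basis. finite_dimensional_vector_space scaleW Basis"
    and "structure_map scaleE actE scaleN actN scaleW \<eta>"
    and "\<exists>n::'n. n \<noteq> 0" and "\<exists>w::'w. w \<noteq> 0"
  shows "mixed_brick scaleB multB unitB scaleE actE scaleN actN scaleW \<eta> \<longleftrightarrow>
    inj \<eta> \<and> stabilizer scaleN actN (range \<eta>) = {\<lambda>n. scaleN c (id n) | c. True}"
proof -
  note E = assms(2) and N = assms(3) and W = assms(4) and eta = assms(5)
  let ?S = "triple_scale scaleN scaleW" and ?A = "triple_act actN scaleW \<eta>"
  let ?brick = "brick (ext_scale scaleB scaleE) (ext_mult multB scaleE actE) (ext_unit unitB) ?S ?A"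
  let ?scalars = "{\<lambda>n. scaleN c (id n) | c. True}"
  interpret L: Vector_Spaces.linear scaleW "scale_fun scaleN" \<eta>
    using eta by (simp add: structure_map_def)
  have scalars: "f \<in> ?scalars \<longleftrightarrow> (\<exists>c. f = scaleN c)" for f
    by (auto simp: fun_eq_iff)
  have "?brick \<longleftrightarrow> inj \<eta> \<and> stabilizer scaleN actN (range \<eta>) = ?scalars"
  proof
    assume brick: ?brick
    then have inj: "inj \<eta>"
      using brick_triple_imp_inj[OF E N W eta assms(6)] by blast
    have "\<exists>c. f = scaleN c" if f: "f \<in> stabilizer scaleN actN (range \<eta>)" for f
    proof -
      obtain g c where "map_prod f g = ?S c"
        using stabilizer_extends_to_triple[OF E N W eta inj f]
          brick_End_right_scalar[OF brick] by blast
      then have "map_prod f g (n, 0) = ?S c (n, 0)" for n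
        by simp
      then have "f = scaleN c"
        by (simp add: fun_eq_iff triple_scale_def)
      then show ?thesis ..
    qed
    then have "stabilizer scaleN actN (range \<eta>) = ?scalars"
      using scalar_in_stabilizer[OF N eta] unfolding set_eq_iff scalars by blast
    with inj show "inj \<eta> \<and> stabilizer scaleN actN (range \<eta>) = ?scalars" ..
  next
    assume R: "inj \<eta> \<and> stabilizer scaleN actN (range \<eta>) = ?scalars"
    show ?brick
    proof (rule brick_if_End_right_scalar[OF fd_right_module_triple[OF E N W eta]])
      show "\<exists>v :: 'n \<times> 'w. v \<noteq> 0"
        using assms(6) by (auto simp: zero_prod_def)
      fix h assume "h \<in> End_right ?S ?A"
      then obtain f g where h: "h = map_prod f g" and f: "f \<in> End_right scaleN actN"
        and fg: "\<And>w. f \<circ> \<eta> w = \<eta> (g w)"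
        unfolding End_triple_iff[OF E N W eta] by blast
      then have "f \<in> stabilizer scaleN actN (range \<eta>)"
        by (auto simp: stabilizer_def)
      then obtain c where c: "f = scaleN c"
        using R scalars by blast
      have "\<eta> (g w) = \<eta> (scaleW c w)" for w
        unfolding fg[symmetric] by (simp add: c L.scale scale_fun_def fun_eq_iff)
      then have "g w = scaleW c w" for w
        using R by (simp add: inj_eq)
      then have "h = ?S c"
        by (simp add: h c triple_scale_def fun_eq_iff)
      then show "\<exists>c. h = ?S c" ..
    qed
  qed
  then show ?thesis
    using assms(6,7) by (simp add: mixed_brick_def)
qed

end
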